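(* Let $\mathsf{H}$ be a quaternionic Hilbert space and let $T\in\mathfrak{B}(\mathsf{H})$ be an operator. Then $\rho_S(T)=\rho_S(T^* )$ and $\sigma_S(T)=\sigma_S(T^* )$.
   Context: $\mathbb{H}$ denotes the quaternions, with conjugation $q\mapsto\overline q$ and norm $|q|=\sqrt{q\overline q}$. A quaternionic Hilbert space $\mathsf{H}$ is a nonzero right $\mathbb{H}$-module with a scalar product $\langle\cdot|\cdot\rangle$ valued in $\mathbb{H}$, right $\mathbb{H}$-linear in the second argument, with $\langle u|v\rangle=\overline{\langle v|u\rangle}$, $\langle u|u\rangle\ge0$ (zero only for $u=0$), complete for $\|u\|=\sqrt{\langle u|u\rangle}$. $\mathfrak{B}(\mathsf{H})$ is the set of bounded right $\mathbb{H}$-linear operators $\mathsf{H}\to\mathsf{H}$; $T^*$ is the adjoint, $\langle T^*u|v\rangle=\langle u|Tv\rangle$. For $q\in\mathbb{H}$, $\Delta_q(T):=T^2-T(q+\overline q)+\mathrm{I}|q|^2$, where $(Tr)(u)=T(u)r$ for $r\in\mathbb{R}$. The spherical resolvent set $\rho_S(T)$ is the set of $q\in\mathbb{H}$ such that $\mathrm{Ker}(\Delta_q(T))=\{0\}$, $\mathrm{Ran}(\Delta_q(T))$ is dense in $\mathsf{H}$ and $\Delta_q(T)^{-1}:\mathrm{Ran}(\Delta_q(T))\to\mathsf{H}$ is bounded; the spherical spectrum is $\sigma_S(T):=\mathbb{H}\setminus\rho_S(T)$. *)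

theory Defs
  imports "HOL-Analysis.Analysis"
begin

section \<open>Quaternions\<close>

datatype quat = Quat (qRe: real) (qI: real) (qJ: real) (qK: real)

lemma quat_eq_iff: "p = q \<longleftrightarrow> qRe p = qRe q \<and> qI p = qI q \<and> qJ p = qJ q \<and> qK p = qK q"
  by (auto intro: quat.expand)

instantiation quat :: ring_1
begin

definition "0 = Quat 0 0 0 0"
definition "1 = Quat 1 0 0 0"
definition "p + q = Quat (qRe p + qRe q) (qI p + qI q) (qJ p + qJ q) (qK p + qK q)"
definition "- q = Quat (- qRe q) (- qI q) (- qJ q) (- qK q)"
definition "p - q = Quat (qRe p - qRe q) (qI p - qI q) (qJ p - qJ q) (qK p - qK q)"
definition "p * q = Quat
  (qRe p * qRe q - qI p * qI q - qJ p * qJ q - qK p * qK q)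
  (qRe p * qI q + qI p * qRe q + qJ p * qK q - qK p * qJ q)
  (qRe p * qJ q - qI p * qK q + qJ p * qRe q + qK p * qI q)
  (qRe p * qK q + qI p * qJ q - qJ p * qI q + qK p * qRe q)"

instance
  by standard
    (simp_all add: zero_quat_def one_quat_def plus_quat_def uminus_quat_def minus_quat_def
      times_quat_def algebra_simps)

end

definition qcnj :: "quat \<Rightarrow> quat" where
  "qcnj q = Quat (qRe q) (- qI q) (- qJ q) (- qK q)"

instantiation quat :: real_algebra_1
begin

definition "r *\<^sub>R q = Quat (r * qRe q) (r * qI q) (r * qJ q) (r * qK q)"

instance
  by standard
    (simp_all add: plus_quat_def times_quat_def one_quat_def scaleR_quat_def algebra_simps)

end

lemma quat_sel_simps [simp]:
  "qRe 0 = 0" "qI 0 = 0" "qJ 0 = 0" "qK 0 = 0"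
  "qRe 1 = 1" "qI 1 = 0" "qJ 1 = 0" "qK 1 = 0"
  "qRe (p + q) = qRe p + qRe q" "qI (p + q) = qI p + qI q"
  "qJ (p + q) = qJ p + qJ q" "qK (p + q) = qK p + qK q"
  "qRe (- q) = - qRe q" "qI (- q) = - qI q" "qJ (- q) = - qJ q" "qK (- q) = - qK q"
  "qRe (p - q) = qRe p - qRe q" "qI (p - q) = qI p - qI q"
  "qJ (p - q) = qJ p - qJ q" "qK (p - q) = qK p - qK q"
  "qRe (r *\<^sub>R q) = r * qRe q" "qI (r *\<^sub>R q) = r * qI q"
  "qJ (r *\<^sub>R q) = r * qJ q" "qK (r *\<^sub>R q) = r * qK q"
  "qRe (qcnj q) = qRe q" "qI (qcnj q) = - qI q" "qJ (qcnj q) = - qJ q" "qK (qcnj q) = - qK q"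
  by (simp_all add: zero_quat_def one_quat_def plus_quat_def uminus_quat_def minus_quat_def
      scaleR_quat_def qcnj_def)

lemma quat_of_real_sel [simp]:
  "qRe (of_real r) = r" "qI (of_real r) = 0" "qJ (of_real r) = 0" "qK (of_real r) = 0"
  by (simp_all add: of_real_def)

lemma qRe_mult_qcnj: "qRe (q * qcnj q) = (qRe q)\<^sup>2 + (qI q)\<^sup>2 + (qJ q)\<^sup>2 + (qK q)\<^sup>2"
  by (simp add: times_quat_def power2_eq_square)

lemma quat_mult_qcnj: "q * qcnj q = of_real (qRe (q * qcnj q))"
  by (simp add: quat_eq_iff) (simp add: times_quat_def)

instantiation quat :: real_normed_algebra_1
begin

definition "norm q = sqrt (qRe (q * qcnj q))"
definition "sgn (q::quat) = q /\<^sub>R norm q"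
definition "dist p q = norm (p - q :: quat)"
definition [code del]:
  "(uniformity :: (quat \<times> quat) filter) = (INF e\<in>{0 <..}. principal {(p, q). dist p q < e})"
definition [code del]:
  "open (U :: quat set) \<longleftrightarrow> (\<forall>p\<in>U. eventually (\<lambda>(p', q). p' = p \<longrightarrow> q \<in> U) uniformity)"

instance
proof
  have norm_pair: "norm q = norm ((qRe q, qI q), (qJ q, qK q))" for q :: quat
    by (simp add: norm_quat_def qRe_mult_qcnj norm_Pair)
  fix p q :: quat and r :: real and U :: "quat set"
  show "dist p q = norm (p - q)" by (rule dist_quat_def)
  show "sgn q = q /\<^sub>R norm q" by (rule sgn_quat_def)
  show "uniformity = (INF e\<in>{0 <..}. principal {(p, q :: quat). dist p q < e})"
    by (rule uniformity_quat_def)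
  show "open U \<longleftrightarrow> (\<forall>p\<in>U. eventually (\<lambda>(p', q). p' = p \<longrightarrow> q \<in> U) uniformity)"
    by (rule open_quat_def)
  show "norm q = 0 \<longleftrightarrow> q = 0"
    unfolding norm_pair by (auto simp: quat_eq_iff prod_eq_iff)
  show "norm (p + q) \<le> norm p + norm q"
    unfolding norm_pair
    using norm_triangle_ineq[of "((qRe p, qI p), (qJ p, qK p))" "((qRe q, qI q), (qJ q, qK q))"]
    by simp
  show "norm (r *\<^sub>R q) = \<bar>r\<bar> * norm q"
    unfolding norm_pair using norm_scaleR[of r "((qRe q, qI q), (qJ q, qK q))"] by simp
  have "qRe ((p * q) * qcnj (p * q)) = qRe (p * qcnj p) * qRe (q * qcnj q)"
    unfolding qRe_mult_qcnj
    by (simp add: times_quat_def power2_eq_square algebra_simps)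
  then show "norm (p * q) \<le> norm p * norm q"
    by (simp add: norm_quat_def real_sqrt_mult)
  show "norm (1 :: quat) = 1"
    by (simp add: norm_quat_def qRe_mult_qcnj)
qed

end

section \<open>Quaternionic Hilbert spaces\<close>

text \<open>
  The superclass \<^class>\<open>banach\<close> contributes the additive group, the real scalar multiplication,
  the norm with its topology, and completeness. The axioms \<open>scaleR_eq_qscale\<close> and
  \<open>norm_eq_sqrt_qinner\<close> tie the scalar multiplication and the norm to the quaternionic structure,
  so that completeness is completeness for \<open>\<parallel>u\<parallel> = \<surd>\<langle>u|u\<rangle>\<close>.
\<close>

class quaternionic_hilbert = banach +
  fixes qscale :: "'a \<Rightarrow> quat \<Rightarrow> 'a"  (infixl "\<bullet>\<^sub>q" 75)
    and qinner :: "'a \<Rightarrow> 'a \<Rightarrow> quat"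
  assumes qscale_add_left: "(u + v) \<bullet>\<^sub>q q = u \<bullet>\<^sub>q q + v \<bullet>\<^sub>q q"
    and qscale_add_right: "u \<bullet>\<^sub>q (p + q) = u \<bullet>\<^sub>q p + u \<bullet>\<^sub>q q"
    and qscale_mult: "u \<bullet>\<^sub>q (p * q) = (u \<bullet>\<^sub>q p) \<bullet>\<^sub>q q"
    and qscale_one: "u \<bullet>\<^sub>q 1 = u"
    and ex_nonzero: "\<exists>u. u \<noteq> 0"
    and qinner_add_right: "qinner u (v + w) = qinner u v + qinner u w"
    and qinner_qscale_right: "qinner u (v \<bullet>\<^sub>q q) = qinner u v * q"
    and qinner_commute: "qinner u v = qcnj (qinner v u)"
    and qinner_nonneg: "\<exists>r\<ge>0. qinner u u = of_real r"
    and qinner_eq_zero: "qinner u u = 0 \<Longrightarrow> u = 0"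
    and scaleR_eq_qscale: "r *\<^sub>R u = u \<bullet>\<^sub>q of_real r"
    and norm_eq_sqrt_qinner: "norm u = sqrt (qRe (qinner u u))"

section \<open>Bounded operators and the spherical spectrum\<close>

definition bounded_qlinear :: "('a::quaternionic_hilbert \<Rightarrow> 'a) \<Rightarrow> bool" where
  "bounded_qlinear T \<longleftrightarrow> bounded_linear T \<and> (\<forall>u q. T (u \<bullet>\<^sub>q q) = T u \<bullet>\<^sub>q q)"

definition qadjoint :: "('a::quaternionic_hilbert \<Rightarrow> 'a) \<Rightarrow> 'a \<Rightarrow> 'a" where
  "qadjoint T = (THE S. bounded_qlinear S \<and> (\<forall>u v. qinner (S u) v = qinner u (T v)))"

definition Delta_S :: "quat \<Rightarrow> ('a::quaternionic_hilbert \<Rightarrow> 'a) \<Rightarrow> 'a \<Rightarrow> 'a" where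
  "Delta_S q T u = T (T u) - T u \<bullet>\<^sub>q (q + qcnj q) + u \<bullet>\<^sub>q of_real ((norm q)\<^sup>2)"

text \<open>
  Under the first condition \<open>Delta_S q T\<close> is injective, so on its range \<^const>\<open>inv\<close> is the genuine
  inverse.
\<close>

definition rho_S :: "('a::quaternionic_hilbert \<Rightarrow> 'a) \<Rightarrow> quat set" where
  "rho_S T = {q. {u. Delta_S q T u = 0} = {0}
    \<and> closure (range (Delta_S q T)) = UNIV
    \<and> (\<exists>K. \<forall>v \<in> range (Delta_S q T). norm (inv (Delta_S q T) v) \<le> K * norm v)}"

definition sigma_S :: "('a::quaternionic_hilbert \<Rightarrow> 'a) \<Rightarrow> quat set" where
  "sigma_S T = UNIV - rho_S T"

end

theory Submission
  imports Defs
begin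

text \<open>
  Every \<open>q + qcnj q\<close> is real, so \<open>Delta_S q (qadjoint T)\<close> is the adjoint of the bounded operator
  \<open>D = Delta_S q T\<close>. If \<open>q \<in> rho_S T\<close>, then \<open>D\<close> is bounded below, so its dense range is closed
  and \<open>D\<close> has an everywhere defined bounded inverse, whose adjoint inverts the adjoint of \<open>D\<close>.
  The converse follows since \<open>qadjoint (qadjoint T) = T\<close>. Adjoints come from the Riesz
  representation theorem, proved by minimizing \<open>(norm v)\<^sup>2 / 2 - f v\<close>; it is enough to treat
  real-valued functionals on the underlying real Hilbert space, because a quaternion \<open>p\<close> is
  determined by the real parts of the products \<open>p * q\<close>.
\<close>

section \<open>The underlying real Hilbert space\<close>

text \<open>Taking real parts gives a symmetric real bilinear form with the same norm, so real
  Hilbert space arguments apply without noncommutative scalars.\<close>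

definition rinner :: "'a::quaternionic_hilbert \<Rightarrow> 'a \<Rightarrow> real" where
  "rinner u v = qRe (qinner u v)"

lemma rinner_commute: "rinner u v = rinner v u"
  unfolding rinner_def by (subst qinner_commute) simp

lemma rinner_add_right: "rinner u (v + w) = rinner u v + rinner u w"
  by (simp add: rinner_def qinner_add_right)

lemma rinner_scaleR_right: "rinner u (r *\<^sub>R v) = r * rinner u v"
  by (simp add: rinner_def scaleR_eq_qscale qinner_qscale_right times_quat_def)

lemma rinner_add_left: "rinner (u + v) w = rinner u w + rinner v w"
  by (metis rinner_add_right rinner_commute)

lemma rinner_scaleR_left: "rinner (r *\<^sub>R u) v = r * rinner u v"
  by (metis rinner_scaleR_right rinner_commute)

lemma rinner_diff_left: "rinner (u - v) w = rinner u w - rinner v w"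
  using rinner_add_left[of "u - v" v w] by simp

lemma rinner_diff_right: "rinner u (v - w) = rinner u v - rinner u w"
  by (metis rinner_diff_left rinner_commute)

lemma rinner_self: "rinner u u = (norm u)\<^sup>2"
  using qinner_nonneg[of u] by (auto simp: rinner_def norm_eq_sqrt_qinner)

lemma rinner_eqI:
  assumes "\<And>v. rinner u v = rinner w v"
  shows "u = w"
proof -
  have "rinner (u - w) (u - w) = 0"
    using assms by (simp add: rinner_diff_left)
  then show ?thesis
    by (simp add: rinner_self)
qed

lemma norm_add_square: "(norm (u + v))\<^sup>2 = (norm u)\<^sup>2 + 2 * rinner u v + (norm v)\<^sup>2"
  for u v :: "'a::quaternionic_hilbert"
  by (simp add: rinner_self[symmetric] rinner_add_left rinner_add_right rinner_commute[of v u])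

lemma norm_diff_square: "(norm (u - v))\<^sup>2 = (norm u)\<^sup>2 - 2 * rinner u v + (norm v)\<^sup>2"
  for u v :: "'a::quaternionic_hilbert"
  by (simp add: rinner_self[symmetric] rinner_diff_left rinner_diff_right rinner_commute[of v u])

text \<open>First-order condition at a minimum. For \<open>c > 0\<close> the vertex
  \<open>t = - a / (2 * c)\<close> has value \<open>- a\<^sup>2 / (4 * c)\<close>; otherwise
  \<open>t = 1\<close> and \<open>t = -1\<close> bound \<open>a\<close> from both sides.\<close>

lemma quadratic_nonneg_imp_linear_zero:
  fixes a c :: real
  assumes "\<And>t. 0 \<le> t * a + t\<^sup>2 * c"
  shows "a = 0"
proof (cases "c > 0")
  case True
  with assms[of "- a / (2 * c)"] have "a\<^sup>2 / (4 * c) \<le> 0"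
    by (simp add: field_simps power2_eq_square)
  with True show ?thesis
    by (simp add: divide_le_0_iff)
next
  case False
  with assms[of 1] assms[of "-1"] show ?thesis
    by simp
qed

text \<open>Cauchy-Schwarz: scaling each vector by the norm of the other makes the expanded square
  factor through \<open>norm u * norm v - rinner u v\<close>.\<close>

lemma rinner_le: "rinner u v \<le> norm u * norm v"
proof (cases "u = 0")
  case True
  then show ?thesis
    using rinner_scaleR_left[of 0 u v] by simp
next
  case False
  have "0 \<le> (norm (norm v *\<^sub>R u - norm u *\<^sub>R v))\<^sup>2"
    by simp
  also have "\<dots> = 2 * (norm u * norm v) * (norm u * norm v - rinner u v)"
    unfolding norm_diff_square rinner_scaleR_left rinner_scaleR_right
    by (simp add: power2_eq_square algebra_simps)
  finally have "v = 0 \<or> rinner u v \<le> norm u * norm v"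
    using False by (auto simp: zero_le_mult_iff mult_le_0_iff)
  then show ?thesis
    using rinner_scaleR_right[of u 0 v] by auto
qed

lemma abs_rinner_le: "\<bar>rinner u v\<bar> \<le> norm u * norm v"
  using rinner_le[of u v] rinner_le[of "- u" v] rinner_scaleR_left[of "-1" u v] by simp

lemma bounded_linear_rinner_right: "bounded_linear (rinner u)"
  by (rule bounded_linear_intro[where K = "norm u"])
    (use abs_rinner_le[of u] in \<open>auto simp: rinner_add_right rinner_scaleR_right mult.commute\<close>)

theorem riesz_representation:
  fixes f :: "'a::quaternionic_hilbert \<Rightarrow> real"
  assumes "bounded_linear f"
  shows "\<exists>w. \<forall>v. f v = rinner w v"
proof -
  interpret f: bounded_linear f by fact
  define J where "J v = (norm v)\<^sup>2 / 2 - f v" for v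
  obtain K where K: "\<And>v. \<bar>f v\<bar> \<le> norm v * K"
    using f.bounded by auto
  \<comment> \<open>Completing the square in \<open>norm v\<close> bounds \<open>J\<close> below, so
    its infimum exists.\<close>
  have "- (K\<^sup>2) / 2 \<le> J v" for v
  proof -
    have "0 \<le> (norm v - K)\<^sup>2" by simp
    then show ?thesis
      using K[of v] by (simp add: J_def power2_diff)
  qed
  then have bdd: "bdd_below (range J)"
    by (meson bdd_belowI2)
  define m where "m = Inf (range J)"
  have m_le: "m \<le> J v" for v
    unfolding m_def using bdd by (simp add: cInf_lower)
  have "\<exists>v. J v < m + inverse (real (Suc n))" for n
    using cInf_lessD[of "range J" "m + inverse (real (Suc n))"] by (auto simp: m_def)
  then obtain x where x: "\<And>n. J (x n) < m + inverse (real (Suc n))"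
    by metis
  \<comment> \<open>Parallelogram law: the linear terms \<open>f\<close> cancel between the
    endpoints and the midpoint.\<close>
  have par: "(norm (u - v))\<^sup>2 = 4 * (J u + J v - 2 * J ((1/2) *\<^sub>R (u + v)))" for u v
    unfolding J_def f.scaleR f.add norm_scaleR power_mult_distrib norm_add_square norm_diff_square
    by (simp add: power2_eq_square field_simps)
  \<comment> \<open>Since \<open>J\<close> is at least \<open>m\<close> at the midpoint,
    near-minimizers must lie close together.\<close>
  have dist_x: "(norm (x i - x j))\<^sup>2 < 8 * inverse (real (Suc N))" if "N \<le> i" "N \<le> j" for i j N
  proof -
    have "J (x i) < m + inverse (real (Suc N))" "J (x j) < m + inverse (real (Suc N))"
      using that by (auto intro!: less_le_trans[OF x] le_imp_inverse_le)
    moreover define c where "c = (1/2) *\<^sub>R (x i + x j)"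
    ultimately show ?thesis
      using m_le[of c] unfolding par c_def[symmetric] by argo
  qed
  have "Cauchy x"
  proof (rule CauchyI)
    fix e :: real
    assume "e > 0"
    then have "0 < e\<^sup>2 / 8" by simp
    then obtain N where "inverse (real (Suc N)) < e\<^sup>2 / 8"
      using reals_Archimedean by blast
    then have "norm (x i - x j) < e" if "N \<le> i" "N \<le> j" for i j
      using dist_x[OF that] \<open>e > 0\<close> by (intro power2_less_imp_less[of _ e]) auto
    then show "\<exists>M. \<forall>i\<ge>M. \<forall>j\<ge>M. norm (x i - x j) < e"
      by blast
  qed
  then obtain w where w: "x \<longlonglongrightarrow> w"
    using Cauchy_convergent convergent_def by blast
  then have "(\<lambda>n. J (x n)) \<longlonglongrightarrow> J w"
    unfolding J_def by (intro tendsto_intros f.tendsto) auto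
  moreover have "(\<lambda>n. m + inverse (real (Suc n))) \<longlonglongrightarrow> m"
    using tendsto_add[OF tendsto_const[of m] LIMSEQ_inverse_real_of_nat] by simp
  ultimately have "J w \<le> m"
    by (rule LIMSEQ_le) (use x in \<open>auto intro: less_imp_le\<close>)
  then have min: "J w \<le> J v" for v
    using m_le[of v] by linarith
  \<comment> \<open>The derivative of \<open>J\<close> at its minimizer \<open>w\<close> vanishes in
    every direction \<open>h\<close>.\<close>
  have "rinner w h - f h = 0" for h
  proof (rule quadratic_nonneg_imp_linear_zero)
    fix t
    show "0 \<le> t * (rinner w h - f h) + t\<^sup>2 * ((norm h)\<^sup>2 / 2)"
      using min[of "w + t *\<^sub>R h"]
      by (simp add: J_def norm_add_square rinner_scaleR_right f.add f.scaleR power_mult_distrib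
          algebra_simps)
  qed
  then show ?thesis
    by (metis eq_iff_diff_eq_0)
qed

section \<open>Adjoints\<close>

text \<open>Multiplying by 1, i, j, k moves each component, up to sign, into the real part.\<close>

lemma quat_eqI_Re_mult:
  assumes "\<And>q. qRe (p * q) = qRe (p' * q)"
  shows "p = p'"
  using assms[of 1] assms[of "Quat 0 1 0 0"] assms[of "Quat 0 0 1 0"] assms[of "Quat 0 0 0 1"]
  by (simp add: quat_eq_iff times_quat_def)

text \<open>Replacing \<open>v\<close> by \<open>v \<bullet>\<^sub>q q\<close> tests the real part
  against every right factor \<open>q\<close>, which recovers the full quaternion.\<close>

lemma qinner_eqI_rinner:
  assumes "\<And>v. rinner u (T v) = rinner w v" "\<And>v q. T (v \<bullet>\<^sub>q q) = T v \<bullet>\<^sub>q q"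
  shows "qinner u (T v) = qinner w v"
proof (rule quat_eqI_Re_mult)
  fix q
  show "qRe (qinner u (T v) * q) = qRe (qinner w v * q)"
    using assms(1)[of "v \<bullet>\<^sub>q q"] by (simp add: rinner_def assms(2) qinner_qscale_right)
qed

lemma qcnj_mult: "qcnj (p * q) = qcnj q * qcnj p"
  by (simp add: quat_eq_iff) (simp add: times_quat_def)

lemma qinner_qscale_left: "qinner (u \<bullet>\<^sub>q q) v = qcnj q * qinner u v"
  by (metis qinner_commute qinner_qscale_right qcnj_mult)

text \<open>Linearity and boundedness come for free from the adjoint relation, so \<open>S\<close>
  may be chosen pointwise.\<close>

lemma bounded_qlinear_if_adjoint:
  assumes T: "bounded_qlinear T" and adj: "\<And>u v. qinner (S u) v = qinner u (T v)"
  shows "bounded_qlinear S"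
proof -
  interpret T: bounded_linear T
    using T by (simp add: bounded_qlinear_def)
  have radj: "rinner (S u) v = rinner u (T v)" for u v
    by (simp add: rinner_def adj)
  obtain K where K: "\<And>v. norm (T v) \<le> norm v * K"
    using T.bounded by blast
  have bound: "norm (S u) \<le> norm u * K" for u
  proof (cases "S u = 0")
    case True
    have "0 \<le> norm u * K"
      using K[of u] norm_ge_zero order_trans by blast
    with True show ?thesis by simp
  next
    case False
    \<comment> \<open>The adjoint relation is tested at \<open>v = S u\<close>; a factor
      \<open>norm (S u)\<close> then cancels.\<close>
    have "norm (S u) * norm (S u) = rinner u (T (S u))"
      using radj[of u "S u"] by (simp add: rinner_self power2_eq_square)
    also have "\<dots> \<le> norm u * (norm (S u) * K)"
      using rinner_le[of u "T (S u)"] mult_left_mono[OF K[of "S u"], of "norm u"]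
      by simp
    finally have "norm (S u) * norm (S u) \<le> norm (S u) * (norm u * K)"
      by (simp add: algebra_simps)
    then show ?thesis
      using False by simp
  qed
  have "bounded_linear S"
  proof (rule bounded_linear_intro[where K = K])
    show "S (u + v) = S u + S v" for u v
      by (rule rinner_eqI) (simp add: radj rinner_add_left)
    show "S (r *\<^sub>R u) = r *\<^sub>R S u" for r u
      by (rule rinner_eqI) (simp add: radj rinner_scaleR_left)
  qed (rule bound)
  moreover have "S (u \<bullet>\<^sub>q q) = S u \<bullet>\<^sub>q q" for u q
    by (rule rinner_eqI) (simp add: rinner_def adj qinner_qscale_left)
  ultimately show ?thesis
    by (simp add: bounded_qlinear_def)
qed

lemma qadjoint_eqI:
  assumes "bounded_qlinear S" "\<And>u v. qinner (S u) v = qinner u (T v)"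
  shows "qadjoint T = S"
  unfolding qadjoint_def
proof (rule the_equality)
  fix R
  assume "bounded_qlinear R \<and> (\<forall>u v. qinner (R u) v = qinner u (T v))"
  then show "R = S"
    by (intro ext rinner_eqI) (simp add: rinner_def assms(2))
qed (use assms in auto)

lemma ex_adjoint:
  assumes T: "bounded_qlinear T"
  shows "\<exists>S. \<forall>u v. qinner (S u) v = qinner u (T v)"
proof -
  have "\<exists>w. \<forall>v. qinner w v = qinner u (T v)" for u
  proof -
    have "bounded_linear (\<lambda>v. rinner u (T v))"
      using T bounded_linear_rinner_right
      by (auto simp: bounded_qlinear_def intro: bounded_linear_compose)
    then obtain w where "\<And>v. rinner u (T v) = rinner w v"
      using riesz_representation by blast
    with T have "qinner u (T v) = qinner w v" for v
      by (intro qinner_eqI_rinner) (auto simp: bounded_qlinear_def)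
    then show ?thesis
      by metis
  qed
  then show ?thesis
    by metis
qed

lemma
  assumes "bounded_qlinear T"
  shows bounded_qlinear_qadjoint: "bounded_qlinear (qadjoint T)"
    and qinner_qadjoint_left: "qinner (qadjoint T u) v = qinner u (T v)"
proof -
  obtain S where S: "\<And>u v. qinner (S u) v = qinner u (T v)"
    using ex_adjoint[OF assms] by blast
  then have "bounded_qlinear S"
    by (rule bounded_qlinear_if_adjoint[OF assms])
  moreover from this S have "qadjoint T = S"
    by (rule qadjoint_eqI)
  ultimately show "bounded_qlinear (qadjoint T)" "qinner (qadjoint T u) v = qinner u (T v)"
    using S by auto
qed

lemma qadjoint_qadjoint:
  assumes "bounded_qlinear T"
  shows "qadjoint (qadjoint T) = T"
proof (rule qadjoint_eqI[OF assms])
  show "qinner (T u) v = qinner u (qadjoint T v)" for u v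
    by (metis assms qinner_commute qinner_qadjoint_left)
qed

section \<open>The spherical resolvent set\<close>

text \<open>Only real coefficients occur, so the adjoint of \<open>Delta_S q T\<close> can be
  computed with \<open>rinner\<close> alone.\<close>

lemma Delta_S_eq:
  "Delta_S q T u = T (T u) - (2 * qRe q) *\<^sub>R T u + (norm q)\<^sup>2 *\<^sub>R u"
proof -
  have "q + qcnj q = of_real (2 * qRe q)"
    by (simp add: quat_eq_iff del: of_real_mult)
  then show ?thesis
    unfolding Delta_S_def by (simp only: scaleR_eq_qscale)
qed

lemma bounded_linear_Delta_S:
  assumes "bounded_linear T"
  shows "bounded_linear (Delta_S q T)"
  unfolding Delta_S_eq[abs_def] using assms
  by (intro bounded_linear_add bounded_linear_sub bounded_linear_const_scaleR
      bounded_linear_compose[of T T] bounded_linear_ident)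

lemma rinner_Delta_S_qadjoint:
  assumes "bounded_qlinear T"
  shows "rinner (Delta_S q (qadjoint T) u) v = rinner u (Delta_S q T v)"
proof -
  have "rinner (qadjoint T x) y = rinner x (T y)" for x y
    by (simp add: rinner_def qinner_qadjoint_left[OF assms])
  then show ?thesis
    by (simp add: Delta_S_eq rinner_add_left rinner_add_right rinner_diff_left rinner_diff_right
        rinner_scaleR_left rinner_scaleR_right)
qed

text \<open>An operator bounded below on a complete space has complete, hence closed, range; density
  then forces surjectivity.\<close>

lemma rho_S_iff:
  assumes "bounded_linear T"
  shows "q \<in> rho_S T \<longleftrightarrow> surj (Delta_S q T) \<and> (\<exists>K>0. \<forall>u. norm u \<le> K * norm (Delta_S q T u))"
    (is "_ \<longleftrightarrow> surj ?D \<and> ?B")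
proof -
  interpret D: bounded_linear ?D
    using assms by (rule bounded_linear_Delta_S)
  show ?thesis
  proof
    assume "q \<in> rho_S T"
    then have ker: "{u. ?D u = 0} = {0}" and dense: "closure (range ?D) = UNIV"
      and "\<exists>K. \<forall>v\<in>range ?D. norm (inv ?D v) \<le> K * norm v"
      by (auto simp: rho_S_def)
    then obtain K where "\<forall>v\<in>range ?D. norm (inv ?D v) \<le> K * norm v"
      by (elim exE)
    then have K: "norm (inv ?D (?D u)) \<le> K * norm (?D u)" for u
      by simp
    from ker have "inj ?D"
      by (auto simp: linear_injective_0[OF D.linear])
    \<comment> \<open>Passing to \<open>max K 1\<close> makes the constant positive, hence
      invertible.\<close>
    then have bnd: "norm u \<le> max K 1 * norm (?D u)" for u
      using K[of u] mult_right_mono[of K "max K 1" "norm (?D u)"] by simp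
    have "complete (range ?D)"
    proof (rule complete_isometric_image[where e = "inverse (max K 1)"])
      show "\<forall>u\<in>UNIV. inverse (max K 1) * norm u \<le> norm (?D u)"
        using bnd by (simp add: field_simps)
    qed (auto simp: D.bounded_linear_axioms complete_UNIV)
    then have "surj ?D"
      using dense by (simp add: complete_imp_closed)
    with bnd show "surj ?D \<and> ?B"
      by (intro conjI exI[of _ "max K 1"]) auto
  next
    assume R: "surj ?D \<and> ?B"
    then obtain K where K: "\<And>u. norm u \<le> K * norm (?D u)"
      by blast
    have ker: "{u. ?D u = 0} = {0}"
    proof -
      have "u = 0" if "?D u = 0" for u
        using K[of u] that by simp
      then show ?thesis
        by (auto simp: D.zero)
    qed
    then have "inj ?D"
      by (auto simp: linear_injective_0[OF D.linear])
    then have "\<forall>v\<in>range ?D. norm (inv ?D v) \<le> K * norm v"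
      using K by auto
    with R ker show "q \<in> rho_S T"
      by (auto simp: rho_S_def)
  qed
qed

lemma rho_S_subset_qadjoint:
  assumes T: "bounded_qlinear T"
  shows "rho_S T \<subseteq> rho_S (qadjoint T)"
proof
  fix q
  assume q: "q \<in> rho_S T"
  let ?D = "Delta_S q T" and ?E = "Delta_S q (qadjoint T)"
  have blT: "bounded_linear T" and blA: "bounded_linear (qadjoint T)"
    using T bounded_qlinear_qadjoint[OF T] by (simp_all add: bounded_qlinear_def)
  interpret D: bounded_linear ?D
    using blT by (rule bounded_linear_Delta_S)
  obtain K where surj: "surj ?D" and "K > 0" and K: "\<And>u. norm u \<le> K * norm (?D u)"
    using q by (auto simp: rho_S_iff[OF blT])
  note adj = rinner_Delta_S_qadjoint[OF T]
  have "u = 0" if "?D u = 0" for u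
    using K[of u] that by simp
  then have "inj ?D"
    by (simp add: linear_injective_0[OF D.linear])
  define G where "G = inv ?D"
  have DG: "?D (G v) = v" and GD: "G (?D v) = v" for v
    using surj \<open>inj ?D\<close> by (simp_all add: G_def surj_f_inv_f)
  have normG: "norm (G v) \<le> norm v * K" for v
    using K[of "G v"] by (simp add: DG mult.commute)
  have "bounded_linear G"
  proof (rule bounded_linear_intro[where K = K])
    show "G (u + v) = G u + G v" for u v
      by (metis D.add DG GD)
    show "G (r *\<^sub>R u) = r *\<^sub>R G u" for r u
      by (metis D.scaleR DG GD)
  qed (rule normG)
  have "\<exists>u. y = ?E u" for y
  proof -
    \<comment> \<open>The Riesz vector \<open>u\<close> of this functional is the adjoint of
      \<open>G\<close> applied to \<open>y\<close>; since \<open>G\<close> inverts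
      \<open>?D\<close>, it is a preimage of \<open>y\<close> under \<open>?E\<close>.\<close>
    have "bounded_linear (\<lambda>v. rinner y (G v))"
      by (intro bounded_linear_compose[OF bounded_linear_rinner_right] \<open>bounded_linear G\<close>)
    then obtain u where u: "\<And>v. rinner y (G v) = rinner u v"
      using riesz_representation by blast
    have "y = ?E u"
      by (rule rinner_eqI) (simp add: adj GD flip: u)
    then show ?thesis ..
  qed
  then have "surj ?E"
    by (simp add: surj_def)
  moreover have "norm u \<le> K * norm (?E u)" for u
  proof (cases "u = 0")
    case False
    \<comment> \<open>Writing one copy of \<open>u\<close> as \<open>?D (G u)\<close> and moving
      \<open>?D\<close> across gives the lower bound for \<open>?E\<close> with the same
      \<open>K\<close>.\<close>
    have "norm u * norm u = rinner (?E u) (G u)"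
      by (simp add: adj DG rinner_self power2_eq_square)
    also have "\<dots> \<le> norm (?E u) * (norm u * K)"
      using rinner_le[of "?E u" "G u"] mult_left_mono[OF normG[of u], of "norm (?E u)"] by simp
    finally have "norm u * norm u \<le> norm u * (K * norm (?E u))"
      by (simp add: algebra_simps)
    with False show ?thesis
      by simp
  qed (use \<open>K > 0\<close> in simp)
  ultimately show "q \<in> rho_S (qadjoint T)"
    using \<open>K > 0\<close> by (auto simp: rho_S_iff[OF blA])
qed

theorem proposition4p7:
  fixes T :: "'a::quaternionic_hilbert \<Rightarrow> 'a"
  assumes "bounded_qlinear T"
  shows "rho_S T = rho_S (qadjoint T) \<and> sigma_S T = sigma_S (qadjoint T)"
proof -
  have "rho_S T = rho_S (qadjoint T)"
    using rho_S_subset_qadjoint[OF assms]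
      rho_S_subset_qadjoint[OF bounded_qlinear_qadjoint[OF assms]]
    by (simp add: qadjoint_qadjoint[OF assms])
  then show ?thesis
    by (simp add: sigma_S_def)
qed

end
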